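(* Let $G$ be a finite-dimensional $\mathbb{F}_p$-vector space, $V\le G$ a subspace, and $\beta:G\times G\to\mathbb{F}_p^r$ a bilinear map such that $\beta|_{V\times V}$ has rank at least $s$. Fix cosets $a+V$ and $b+V$ and let $B=\{(x,y)\in(a+V)\times(b+V):\beta(x,y)=0\}$. Let $k,d$ be positive integers, let $Q\subseteq(b+V)^k$ be a set of size $\delta|V|^k$, and let $\eta>0$. Pick $x_1,\dots,x_d$ independently and uniformly at random from $a+V$. Then the probability that \[\Big|\,|Q\cap B_{x_1\cdot}^k\cap\dots\cap B_{x_d\cdot}^k|-\delta p^{-kdr}|V|^k\Big|\ge\eta|V|^k\] is at most $3\eta^{-2}p^{-s/4}$.
   Context: For $x\in a+V$, $B_{x\cdot}=\{y:(x,y)\in B\}$ is the column of $B$ indexed by $x$. A bilinear map $\gamma:V\times V\to\mathbb{F}_p^r$ has rank at least $s$ if for every nonzero $\lambda\in\mathbb{F}_p^r$ the bilinear form $\lambda\cdot\gamma$ (with $\cdot$ the standard dot product) has rank at least $s$ on $V\times V$. *)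

theory Defs
  imports "HOL-Analysis.Analysis"
begin

text \<open>Bilinear maps G x G -> F^r, with G = F^n, over a field F.\<close>
definition bilinear_map :: "('f::field^'n \<Rightarrow> 'f^'n \<Rightarrow> 'f^'r) \<Rightarrow> bool" where
  "bilinear_map \<beta> \<longleftrightarrow>
     (\<forall>x. Vector_Spaces.linear (*s) (*s) (\<lambda>y. \<beta> x y)) \<and>
     (\<forall>y. Vector_Spaces.linear (*s) (*s) (\<lambda>x. \<beta> x y))"

text \<open>Rank of a bilinear form f on V x V: dim V minus the dimension of its (left) radical in V.\<close>
definition form_rank_on :: "('f::field^'n) set \<Rightarrow> ('f^'n \<Rightarrow> 'f^'n \<Rightarrow> 'f) \<Rightarrow> nat" where
  "form_rank_on V f = vec.dim V - vec.dim {x \<in> V. \<forall>y\<in>V. f x y = 0}"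

text \<open>Standard dot product on F^r.\<close>
definition dotp :: "'f::field^'r \<Rightarrow> 'f^'r \<Rightarrow> 'f" where
  "dotp u v = (\<Sum>i\<in>UNIV. u $ i * v $ i)"

text \<open>gamma has rank at least s on V x V: every nonzero lambda gives a form of rank >= s.\<close>
definition bilinear_rank_at_least :: "('f::field^'n) set \<Rightarrow> ('f^'n \<Rightarrow> 'f^'n \<Rightarrow> 'f^'r) \<Rightarrow> nat \<Rightarrow> bool" where
  "bilinear_rank_at_least V \<gamma> s \<longleftrightarrow>
     (\<forall>l::'f^'r. l \<noteq> 0 \<longrightarrow> form_rank_on V (\<lambda>x y. dotp l (\<gamma> x y)) \<ge> s)"

definition coset :: "'a::ab_group_add \<Rightarrow> 'a set \<Rightarrow> 'a set" where
  "coset a V = {a + v | v. v \<in> V}"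

end

(*
  For a tuple zs of length m in b + V let A(zs) be the set of x in a + V with beta x z = 0 for all
  entries z of zs. Summing over the d-tuples xs in a + V, the first and second moments of the count
  c(xs) = |{ys in Q. beta x y = 0 for all x in xs, y in ys}| are sums of |A(ys)|^d over ys in Q and
  of |A(ys @ ys')|^d over pairs in Q x Q.

  Linear algebra computes |A(zs)|: if A(zs) is nonempty it is a coset of the kernel of
  v |-> (beta v z_j)_j, so |A(zs)| p^(rm) = |V| |Ann(zs)|, where Ann(zs) is the annihilator of the
  image of that map in (F^r)^m; if A(zs) is empty, then |Ann(zs)| >= 2. Hence |A(zs)|^d p^(rmd)
  differs from |V|^d by at most |V|^d (|Ann(zs)|^d - 1), and summing over zs counts pairs of zs and
  nonzero d-tuples of annihilating vectors. A nonzero coefficient vector Lambda annihilates at most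
  a p^(-s) fraction of the tuples zs: with all coordinates but one fixed, the free coordinate is
  confined to a translate of the right radical of the form <Lambda_j, beta>, which has at most
  |V| p^(-s) elements by the rank hypothesis. So the variance of c is at most 3 p^(-s) |V|^(2k),
  and Chebyshev's inequality gives the bound, even with p^(-s) in place of p^(-s/4).
*)

theory Submission
  imports Defs "HOL-Library.Function_Algebras"
begin

section \<open>Kernels and radicals over a finite field\<close>

lemma card_eq_card_image_mult_card_kernel:
  fixes \<phi> :: "'a::ab_group_add \<Rightarrow> 'b::ab_group_add"
  assumes "finite U"
    and add: "\<And>u v. u \<in> U \<Longrightarrow> v \<in> U \<Longrightarrow> u + v \<in> U"
    and diff: "\<And>u v. u \<in> U \<Longrightarrow> v \<in> U \<Longrightarrow> u - v \<in> U"
    and hom: "\<And>u v. u \<in> U \<Longrightarrow> v \<in> U \<Longrightarrow> \<phi> (u + v) = \<phi> u + \<phi> v"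
  shows "card U = card (\<phi> ` U) * card {u\<in>U. \<phi> u = 0}"
proof -
  let ?K = "{u\<in>U. \<phi> u = 0}"
  have hom_diff: "\<phi> (u - v) = \<phi> u - \<phi> v" if "u \<in> U" "v \<in> U" for u v
    using hom[of "u - v" v] diff[OF that] that by (simp add: algebra_simps)
  have fibre: "card {u\<in>U. \<phi> u = c} = card ?K" if c: "c \<in> \<phi> ` U" for c
  proof -
    obtain u0 where u0: "u0 \<in> U" "\<phi> u0 = c" using c by auto
    have "bij_betw (\<lambda>k. k + u0) ?K {u\<in>U. \<phi> u = c}"
      by (rule bij_betwI[where g="\<lambda>u. u - u0"]) (use u0 hom add hom_diff diff in auto)
    then show ?thesis by (simp add: bij_betw_same_card)
  qed
  have "card U = card (\<Union>c\<in>\<phi> ` U. {u\<in>U. \<phi> u = c})"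
    by (rule arg_cong[where f=card]) auto
  also have "\<dots> = (\<Sum>c\<in>\<phi> ` U. card {u\<in>U. \<phi> u = c})"
    by (rule card_UN_disjoint) (use \<open>finite U\<close> in auto)
  also have "\<dots> = card (\<phi> ` U) * card ?K" by (simp add: fibre)
  finally show ?thesis .
qed

lemma card_eq_card_field_mult_card_kernel:
  fixes \<phi> :: "'a::ab_group_add \<Rightarrow> 'f::{field,finite}" and scale :: "'f \<Rightarrow> 'a \<Rightarrow> 'a"
  assumes "finite U"
    and "\<And>u v. u \<in> U \<Longrightarrow> v \<in> U \<Longrightarrow> u + v \<in> U"
    and "\<And>u v. u \<in> U \<Longrightarrow> v \<in> U \<Longrightarrow> u - v \<in> U"
    and "\<And>u v. u \<in> U \<Longrightarrow> v \<in> U \<Longrightarrow> \<phi> (u + v) = \<phi> u + \<phi> v"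
    and scale: "\<And>c u. u \<in> U \<Longrightarrow> scale c u \<in> U"
    and hom_scale: "\<And>c u. u \<in> U \<Longrightarrow> \<phi> (scale c u) = c * \<phi> u"
    and u0: "u0 \<in> U" "\<phi> u0 \<noteq> 0"
  shows "card U = CARD('f) * card {u\<in>U. \<phi> u = 0}"
proof -
  have "c \<in> \<phi> ` U" for c
    using hom_scale[OF u0(1), of "c / \<phi> u0"] u0 scale[OF u0(1)] by (simp add: image_iff) metis
  then have "\<phi> ` U = UNIV" by blast
  with card_eq_card_image_mult_card_kernel[of U \<phi>, OF assms(1-4)] show ?thesis by simp
qed

lemma card_field_ge_2: "CARD('f::{field,finite}) \<ge> 2"
proof -
  have "card {0::'f, 1} \<le> CARD('f)" by (rule card_mono) auto
  then show ?thesis by simp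
qed

lemma sum_card_swap:
  "finite A \<Longrightarrow> finite B \<Longrightarrow>
    (\<Sum>x\<in>A. card {y\<in>B. R x y}) = (\<Sum>y\<in>B. card {x\<in>A. R x y})"
  using sum.swap_restrict[of A B "\<lambda>_ _. 1::nat" R] by simp

lemma sum_card_zeros_eq:
  fixes g :: "'a::ab_group_add \<Rightarrow> 'b \<Rightarrow> 'f::{field,finite}" and scale :: "'f \<Rightarrow> 'a \<Rightarrow> 'a"
  assumes "finite U" "finite W"
    and "\<And>u v. u \<in> U \<Longrightarrow> v \<in> U \<Longrightarrow> u + v \<in> U"
    and "\<And>u v. u \<in> U \<Longrightarrow> v \<in> U \<Longrightarrow> u - v \<in> U"
    and "\<And>c u. u \<in> U \<Longrightarrow> scale c u \<in> U"
    and "\<And>u v w. u \<in> U \<Longrightarrow> v \<in> U \<Longrightarrow> w \<in> W \<Longrightarrow> g (u + v) w = g u w + g v w"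
    and "\<And>c u w. u \<in> U \<Longrightarrow> w \<in> W \<Longrightarrow> g (scale c u) w = c * g u w"
  shows "CARD('f) * (\<Sum>w\<in>W. card {u\<in>U. g u w = 0})
           = card W * card U + card {w\<in>W. \<forall>u\<in>U. g u w = 0} * ((CARD('f) - 1) * card U)"
proof -
  let ?R = "{w\<in>W. \<forall>u\<in>U. g u w = 0}"
  have zeros: "CARD('f) * card {u\<in>U. g u w = 0}
      = card U + (if \<forall>u\<in>U. g u w = 0 then (CARD('f) - 1) * card U else 0)"
    if w: "w \<in> W" for w
  proof (cases "\<forall>u\<in>U. g u w = 0")
    case True
    then have "{u\<in>U. g u w = 0} = U" by auto
    with True card_field_ge_2[where 'f='f] show ?thesis by (simp add: algebra_simps)
  next
    case False
    then obtain u0 where u0: "u0 \<in> U" "g u0 w \<noteq> 0" by auto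
    have "card U = CARD('f) * card {u\<in>U. g u w = 0}"
      by (rule card_eq_card_field_mult_card_kernel[where \<phi>="\<lambda>u. g u w" and scale=scale,
            OF assms(1,3,4) _ assms(5) _ u0])
        (simp_all add: assms(6,7) w)
    then show ?thesis unfolding if_not_P[OF False] by simp
  qed
  have "CARD('f) * (\<Sum>w\<in>W. card {u\<in>U. g u w = 0})
      = (\<Sum>w\<in>W. card U + (if \<forall>u\<in>U. g u w = 0 then (CARD('f) - 1) * card U else 0))"
    by (simp add: sum_distrib_left zeros)
  also have "\<dots> = card W * card U + card ?R * ((CARD('f) - 1) * card U)"
    using \<open>finite W\<close> by (simp add: sum.distrib sum.inter_filter[symmetric])
  finally show ?thesis .
qed

lemma card_mult_card_right_radical_eq:
  fixes g :: "'a::ab_group_add \<Rightarrow> 'b::ab_group_add \<Rightarrow> 'f::{field,finite}"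
    and scale\<^sub>U :: "'f \<Rightarrow> 'a \<Rightarrow> 'a" and scale\<^sub>W :: "'f \<Rightarrow> 'b \<Rightarrow> 'b"
  assumes "finite U"
    and "\<And>u v. u \<in> U \<Longrightarrow> v \<in> U \<Longrightarrow> u + v \<in> U"
    and "\<And>u v. u \<in> U \<Longrightarrow> v \<in> U \<Longrightarrow> u - v \<in> U"
    and "\<And>c u. u \<in> U \<Longrightarrow> scale\<^sub>U c u \<in> U"
    and "finite W"
    and "\<And>u v. u \<in> W \<Longrightarrow> v \<in> W \<Longrightarrow> u + v \<in> W"
    and "\<And>u v. u \<in> W \<Longrightarrow> v \<in> W \<Longrightarrow> u - v \<in> W"
    and "\<And>c u. u \<in> W \<Longrightarrow> scale\<^sub>W c u \<in> W"
    and "\<And>u v w. u \<in> U \<Longrightarrow> v \<in> U \<Longrightarrow> w \<in> W \<Longrightarrow> g (u + v) w = g u w + g v w"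
    and "\<And>c u w. u \<in> U \<Longrightarrow> w \<in> W \<Longrightarrow> g (scale\<^sub>U c u) w = c * g u w"
    and "\<And>u v w. u \<in> U \<Longrightarrow> v \<in> W \<Longrightarrow> w \<in> W \<Longrightarrow> g u (v + w) = g u v + g u w"
    and "\<And>c u w. u \<in> U \<Longrightarrow> w \<in> W \<Longrightarrow> g u (scale\<^sub>W c w) = c * g u w"
  shows "card U * card {w\<in>W. \<forall>u\<in>U. g u w = 0} = card W * card {u\<in>U. \<forall>w\<in>W. g u w = 0}"
proof -
  have "card W * card U + card {w\<in>W. \<forall>u\<in>U. g u w = 0} * ((CARD('f) - 1) * card U)
      = CARD('f) * (\<Sum>w\<in>W. card {u\<in>U. g u w = 0})"
    by (rule sum_card_zeros_eq[where scale=scale\<^sub>U, OF assms(1,5,2,3,4,9,10), symmetric])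
  also have "\<dots> = CARD('f) * (\<Sum>u\<in>U. card {w\<in>W. g u w = 0})"
    unfolding sum_card_swap[OF assms(5,1)] ..
  also have "\<dots> = card U * card W + card {u\<in>U. \<forall>w\<in>W. g u w = 0} * ((CARD('f) - 1) * card W)"
    by (rule sum_card_zeros_eq[where g="\<lambda>w u. g u w" and scale=scale\<^sub>W, OF assms(5,1,6,7,8)])
      (simp_all add: assms(11,12))
  finally have "(CARD('f) - 1) * (card U * card {w\<in>W. \<forall>u\<in>U. g u w = 0})
      = (CARD('f) - 1) * (card W * card {u\<in>U. \<forall>w\<in>W. g u w = 0})"
    by (simp add: ac_simps)
  with card_field_ge_2[where 'f='f] show ?thesis by simp
qed

lemma card_le_card_if_diffs_in:
  fixes S :: "'a::ab_group_add set"
  assumes "finite R" and diff: "\<And>y y'. y \<in> S \<Longrightarrow> y' \<in> S \<Longrightarrow> y - y' \<in> R"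
  shows "card S \<le> card R"
proof (cases "S = {}")
  case False
  then obtain y0 where "y0 \<in> S" by blast
  have "inj_on (\<lambda>y. y - y0) S" by (rule inj_onI) simp
  moreover have "(\<lambda>y. y - y0) ` S \<subseteq> R" using diff \<open>y0 \<in> S\<close> by blast
  ultimately show ?thesis using \<open>finite R\<close> by (rule card_inj_on_le)
qed simp

section \<open>Subspaces, cosets and tuples\<close>

lemma (in vector_space) card_subspace:
  assumes "finite (UNIV :: 'a set)" "finite S" "subspace S"
  shows "card S = CARD('a) ^ dim S"
proof -
  obtain B where B: "B \<subseteq> S" "independent B" "S \<subseteq> span B" "card B = dim S"
    using basis_exists by blast
  have "finite B" using B(1) \<open>finite S\<close> by (rule finite_subset)
  have "span B = S" using B assms(3) span_subspace by blast
  let ?comb = "\<lambda>u. \<Sum>v\<in>B. scale (u v) v"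
  have "bij_betw ?comb (B \<rightarrow>\<^sub>E UNIV) (span B)"
  proof (rule bij_betw_imageI)
    show "inj_on ?comb (B \<rightarrow>\<^sub>E UNIV)"
    proof (rule inj_onI)
      fix u w assume u: "u \<in> B \<rightarrow>\<^sub>E UNIV" and w: "w \<in> B \<rightarrow>\<^sub>E UNIV" and "?comb u = ?comb w"
      then have "(\<Sum>v\<in>B. scale (u v - w v) v) = 0"
        by (simp add: scale_left_diff_distrib sum_subtractf)
      have "\<forall>v\<in>B. u v - w v = 0"
      proof (rule ccontr)
        assume "\<not> (\<forall>v\<in>B. u v - w v = 0)"
        with \<open>(\<Sum>v\<in>B. scale (u v - w v) v) = 0\<close> have "dependent B"
          unfolding dependent_finite[OF \<open>finite B\<close>] by (intro exI[of _ "\<lambda>v. u v - w v"]) auto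
        with B(2) show False by simp
      qed
      then show "u = w" using u w by (intro PiE_ext) auto
    qed
    show "?comb ` (B \<rightarrow>\<^sub>E UNIV) = span B"
    proof
      show "?comb ` (B \<rightarrow>\<^sub>E UNIV) \<subseteq> span B"
        unfolding span_finite[OF \<open>finite B\<close>] by blast
      show "span B \<subseteq> ?comb ` (B \<rightarrow>\<^sub>E UNIV)"
      proof
        fix x assume "x \<in> span B"
        then obtain u where "x = ?comb u" unfolding span_finite[OF \<open>finite B\<close>] by blast
        also have "?comb u = ?comb (restrict u B)" by (intro sum.cong) auto
        finally show "x \<in> ?comb ` (B \<rightarrow>\<^sub>E UNIV)" by (auto intro!: image_eqI[where x="restrict u B"])
      qed
    qed
  qed
  then have "card S = card (B \<rightarrow>\<^sub>E (UNIV :: 'a set))"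
    unfolding \<open>span B = S\<close> by (rule bij_betw_same_card[symmetric])
  also have "\<dots> = CARD('a) ^ dim S" using \<open>finite B\<close> B(4) by (simp add: card_PiE)
  finally show ?thesis .
qed

lemma dotp_add_right: "dotp l (u + v) = dotp l u + dotp l v"
  by (simp add: dotp_def distrib_left sum.distrib)

lemma dotp_add_left: "dotp (l + l') u = dotp l u + dotp l' u"
  by (simp add: dotp_def distrib_right sum.distrib)

lemma dotp_diff_right: "dotp l (u - v) = dotp l u - dotp l v"
  by (simp add: dotp_def algebra_simps sum_subtractf)

lemma dotp_scale_right: "dotp l (c *s u) = c * dotp l u"
  by (simp add: dotp_def sum_distrib_left algebra_simps)

lemma dotp_scale_left: "dotp (c *s l) u = c * dotp l u"
  by (simp add: dotp_def sum_distrib_left algebra_simps)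

lemma dotp_zero_right [simp]: "dotp l 0 = 0"
  by (simp add: dotp_def)

lemma dotp_zero_left [simp]: "dotp 0 u = 0"
  by (simp add: dotp_def)

lemma dotp_axis_left: "dotp (axis i 1) u = u $ i"
proof -
  have "dotp (axis i 1) u = (\<Sum>j\<in>UNIV. if j = i then u $ i else 0)"
    unfolding dotp_def by (intro sum.cong) (auto simp: axis_def)
  then show ?thesis by simp
qed

lemma mem_coset_iff: "x \<in> coset a V \<longleftrightarrow> x - a \<in> V"
  unfolding coset_def by (auto intro: exI[of _ "x - a"])

lemma card_coset: "card (coset a V) = card V"
proof -
  have "coset a V = (+) a ` V" unfolding coset_def by auto
  then show ?thesis by (simp add: card_image)
qed

definition tuples :: "'a set \<Rightarrow> nat \<Rightarrow> 'a list set" where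
  "tuples A m = {xs. set xs \<subseteq> A \<and> length xs = m}"

lemma finite_tuples: "finite A \<Longrightarrow> finite (tuples A m)"
  unfolding tuples_def by (rule finite_lists_length_eq)

lemma card_tuples: "finite A \<Longrightarrow> card (tuples A m) = card A ^ m"
  unfolding tuples_def by (rule card_lists_length_eq)

lemma bij_betw_tuples_update:
  assumes "a0 \<in> A" "j < m"
  shows "bij_betw (\<lambda>zs. (zs[j:=a0], zs ! j)) (tuples A m) ({ws \<in> tuples A m. ws ! j = a0} \<times> A)"
proof (rule bij_betwI[where g="\<lambda>(ws, y). ws[j:=y]"])
  show "(\<lambda>zs. (zs[j:=a0], zs ! j)) \<in> tuples A m \<rightarrow> {ws \<in> tuples A m. ws ! j = a0} \<times> A"
  proof
    fix zs assume "zs \<in> tuples A m"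
    then have "set zs \<subseteq> A" "length zs = m" by (auto simp: tuples_def)
    then have "set (zs[j:=a0]) \<subseteq> A" "zs ! j \<in> A"
      using set_update_subset_insert[of zs j a0] assms by auto
    with \<open>length zs = m\<close> \<open>j < m\<close>
    show "(zs[j:=a0], zs ! j) \<in> {ws \<in> tuples A m. ws ! j = a0} \<times> A" by (simp add: tuples_def)
  qed
  show "(\<lambda>(ws, y). ws[j:=y]) \<in> {ws \<in> tuples A m. ws ! j = a0} \<times> A \<rightarrow> tuples A m"
  proof
    fix wy assume "wy \<in> {ws \<in> tuples A m. ws ! j = a0} \<times> A"
    then obtain ws y where "wy = (ws, y)" "ws \<in> tuples A m" "y \<in> A" by blast
    then show "(\<lambda>(ws, y). ws[j:=y]) wy \<in> tuples A m"
      using set_update_subset_insert[of ws j y] by (auto simp: tuples_def)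
  qed
qed (use \<open>j < m\<close> in \<open>auto simp: tuples_def\<close>)

lemma card_tuples_by_slices:
  assumes "finite A" "j < m"
    and slice: "\<And>ws. ws \<in> tuples A m \<Longrightarrow> card {y\<in>A. P (ws[j:=y])} \<le> K"
  shows "card {zs \<in> tuples A m. P zs} * card A \<le> card A ^ m * K"
proof (cases "A = {}")
  case False
  then obtain a0 where "a0 \<in> A" by blast
  let ?T0 = "{ws \<in> tuples A m. ws ! j = a0}"
  let ?split = "\<lambda>zs. (zs[j:=a0], zs ! j)"
  have bij: "bij_betw ?split (tuples A m) (?T0 \<times> A)"
    using \<open>a0 \<in> A\<close> \<open>j < m\<close> by (rule bij_betw_tuples_update)
  then have "card {zs \<in> tuples A m. P zs} = card (?split ` {zs \<in> tuples A m. P zs})"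
    by (intro card_image[symmetric] inj_on_subset[OF bij_betw_imp_inj_on]) auto
  also have "\<dots> \<le> card (SIGMA ws:?T0. {y\<in>A. P (ws[j:=y])})"
  proof (rule card_mono)
    show "finite (SIGMA ws:?T0. {y\<in>A. P (ws[j:=y])})"
      using finite_tuples[OF \<open>finite A\<close>, of m] \<open>finite A\<close> by simp
    show "?split ` {zs \<in> tuples A m. P zs} \<subseteq> (SIGMA ws:?T0. {y\<in>A. P (ws[j:=y])})"
    proof
      fix x assume "x \<in> ?split ` {zs \<in> tuples A m. P zs}"
      then obtain zs where zs: "zs \<in> tuples A m" "P zs" "x = ?split zs" by blast
      then have "?split zs \<in> ?T0 \<times> A" using bij by (auto simp: bij_betw_def)
      with zs show "x \<in> (SIGMA ws:?T0. {y\<in>A. P (ws[j:=y])})" by simp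
    qed
  qed
  also have "\<dots> = (\<Sum>ws\<in>?T0. card {y\<in>A. P (ws[j:=y])})"
    using finite_tuples[OF \<open>finite A\<close>, of m] \<open>finite A\<close> by (intro card_SigmaI) auto
  also have "\<dots> \<le> card ?T0 * K" using sum_bounded_above[of ?T0 _ K] slice by simp
  finally have "card {zs \<in> tuples A m. P zs} * card A \<le> card ?T0 * card A * K"
    by (simp add: mult_right_mono ac_simps)
  also have "card ?T0 * card A = card A ^ m"
    using bij_betw_same_card[OF bij] \<open>finite A\<close> by (simp add: card_cartesian_product card_tuples)
  finally show ?thesis .
qed simp

section \<open>Annihilators in coefficient space\<close>

(* (F^r)^m is modelled by the functions on nat that vanish from m on, so that coefficient vectors
   for tuples of different lengths share one type. *)
definition coeff_space :: "nat \<Rightarrow> (nat \<Rightarrow> 'a::zero) set" where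
  "coeff_space m = {\<Lambda>. \<forall>j\<ge>m. \<Lambda> j = 0}"

definition pairing :: "nat \<Rightarrow> (nat \<Rightarrow> 'f::field^'r) \<Rightarrow> (nat \<Rightarrow> 'f^'r) \<Rightarrow> 'f" where
  "pairing m \<Lambda> w = (\<Sum>j<m. dotp (\<Lambda> j) (w j))"

lemma bij_betw_coeff_space_PiE:
  "bij_betw (\<lambda>\<Lambda>. restrict \<Lambda> {..<m}) (coeff_space m) ({..<m} \<rightarrow>\<^sub>E UNIV)"
  by (rule bij_betwI[where g="\<lambda>f j. if j < m then f j else 0"])
    (auto simp: coeff_space_def fun_eq_iff PiE_def extensional_def)

lemma finite_coeff_space: "finite (coeff_space m :: (nat \<Rightarrow> 'a::{zero,finite}) set)"
  by (simp add: bij_betw_finite[OF bij_betw_coeff_space_PiE[of m]] finite_PiE)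

lemma card_coeff_space:
  "card (coeff_space m :: (nat \<Rightarrow> 'f::{field,finite}^'r) set) = CARD('f) ^ (CARD('r) * m)"
proof -
  have "card (coeff_space m :: (nat \<Rightarrow> 'f^'r) set) = card ({..<m} \<rightarrow>\<^sub>E (UNIV :: ('f^'r) set))"
    by (rule bij_betw_same_card[OF bij_betw_coeff_space_PiE])
  then show ?thesis by (simp add: card_PiE power_mult)
qed

lemma pairing_add_left: "pairing m (\<Lambda> + \<Lambda>') w = pairing m \<Lambda> w + pairing m \<Lambda>' w"
  by (simp add: pairing_def dotp_add_left sum.distrib)

lemma pairing_add_right: "pairing m \<Lambda> (w + w') = pairing m \<Lambda> w + pairing m \<Lambda> w'"
  by (simp add: pairing_def dotp_add_right sum.distrib)

lemma pairing_scale_left: "pairing m (\<lambda>j. c *s \<Lambda> j) w = c * pairing m \<Lambda> w"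
  by (simp add: pairing_def dotp_scale_left sum_distrib_left)

lemma pairing_scale_right: "pairing m \<Lambda> (\<lambda>j. c *s w j) = c * pairing m \<Lambda> w"
  by (simp add: pairing_def dotp_scale_right sum_distrib_left)

lemma pairing_axis:
  assumes "j < m"
  shows "pairing m (\<lambda>j'. if j' = j then axis i 1 else 0) w = w j $ i"
proof -
  have "pairing m (\<lambda>j'. if j' = j then axis i 1 else 0) w = (\<Sum>j'<m. if j' = j then w j $ i else 0)"
    unfolding pairing_def by (intro sum.cong) (auto simp: dotp_axis_left)
  with assms show ?thesis by simp
qed

lemma card_coeff_space_eq_card_mult_card_annihilator:
  fixes W :: "(nat \<Rightarrow> 'f::{field,finite}^'r) set"
  assumes "W \<subseteq> coeff_space m" "0 \<in> W"
    and "\<And>u v. u \<in> W \<Longrightarrow> v \<in> W \<Longrightarrow> u + v \<in> W"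
    and "\<And>u v. u \<in> W \<Longrightarrow> v \<in> W \<Longrightarrow> u - v \<in> W"
    and "\<And>c u. u \<in> W \<Longrightarrow> (\<lambda>j. c *s u j) \<in> W"
  shows "card (coeff_space m :: (nat \<Rightarrow> 'f^'r) set)
           = card W * card {\<Lambda>\<in>coeff_space m. \<forall>w\<in>W. pairing m \<Lambda> w = 0}"
proof -
  have "finite W" using assms(1) finite_coeff_space by (rule finite_subset)
  have "{w\<in>W. \<forall>\<Lambda>\<in>coeff_space m. pairing m \<Lambda> w = 0} = {0}"
  proof safe
    fix w assume w: "w \<in> W" "\<forall>\<Lambda>\<in>coeff_space m. pairing m \<Lambda> w = 0"
    have "w j $ i = 0" if "j < m" for i j
      using w(2) pairing_axis[OF that, of i w] that by (auto simp: coeff_space_def)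
    moreover have "w j = 0" if "\<not> j < m" for j
      using w(1) assms(1) that by (auto simp: coeff_space_def)
    ultimately show "w = 0" by (auto simp: fun_eq_iff vec_eq_iff)
  qed (use assms(2) in \<open>simp_all add: pairing_def\<close>)
  moreover have "card (coeff_space m :: (nat \<Rightarrow> 'f^'r) set)
      * card {w\<in>W. \<forall>\<Lambda>\<in>coeff_space m. pairing m \<Lambda> w = 0}
      = card W * card {\<Lambda>\<in>coeff_space m. \<forall>w\<in>W. pairing m \<Lambda> w = 0}"
    by (rule card_mult_card_right_radical_eq[where scale\<^sub>U="\<lambda>c u j. c *s u j"
          and scale\<^sub>W="\<lambda>c u j. c *s u j"])
      (use finite_coeff_space \<open>finite W\<close> assms(3-5) in
        \<open>auto simp: coeff_space_def pairing_add_left pairing_add_right pairing_scale_left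
          pairing_scale_right\<close>)
  ultimately show ?thesis by simp
qed

section \<open>Second moments\<close>

lemma sum_square_deviation_eq:
  fixes c :: "'a \<Rightarrow> real" and P q E\<^sub>1 E\<^sub>2 :: real
  assumes "finite X" "P \<noteq> 0"
    and "(\<Sum>x\<in>X. c x) * P = q * real (card X) + E\<^sub>1"
    and "(\<Sum>x\<in>X. c x ^ 2) * P ^ 2 = q ^ 2 * real (card X) + E\<^sub>2"
  shows "(\<Sum>x\<in>X. (c x - q / P) ^ 2) = (E\<^sub>2 - 2 * q * E\<^sub>1) / P ^ 2"
proof -
  have "(c x - q / P) ^ 2 = c x ^ 2 - 2 * (q / P) * c x + (q / P) ^ 2" for x
    by (simp add: power2_diff)
  then have "(\<Sum>x\<in>X. (c x - q / P) ^ 2) = (\<Sum>x\<in>X. c x ^ 2 - 2 * (q / P) * c x + (q / P) ^ 2)"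
    by (simp only:)
  also have "\<dots> = (\<Sum>x\<in>X. c x ^ 2) - 2 * (q / P) * (\<Sum>x\<in>X. c x) + real (card X) * (q / P) ^ 2"
    by (simp only: sum.distrib sum_subtractf sum_distrib_left[symmetric] sum_constant)
  also have "\<dots> = (E\<^sub>2 - 2 * q * E\<^sub>1) / P ^ 2"
  proof -
    have s1: "(\<Sum>x\<in>X. c x) = (q * real (card X) + E\<^sub>1) / P"
      using assms(2,3) by (simp add: eq_divide_eq)
    have s2: "(\<Sum>x\<in>X. c x ^ 2) = (q ^ 2 * real (card X) + E\<^sub>2) / P ^ 2"
      using assms(2,4) by (simp add: eq_divide_eq)
    show ?thesis unfolding s1 s2 using assms(2) by (simp add: field_simps power2_eq_square)
  qed
  finally show ?thesis .
qed

lemma sum_square_deviation_le: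
  fixes c :: "'a \<Rightarrow> real" and P q M S E\<^sub>1 E\<^sub>2 :: real
  assumes "finite X" "1 \<le> P" "0 \<le> q" "q \<le> M" "0 \<le> S"
    and "(\<Sum>x\<in>X. c x) * P = q * real (card X) + E\<^sub>1"
    and "(\<Sum>x\<in>X. c x ^ 2) * P ^ 2 = q ^ 2 * real (card X) + E\<^sub>2"
    and E\<^sub>1: "\<bar>E\<^sub>1\<bar> * S \<le> real (card X) * P * M"
    and E\<^sub>2: "\<bar>E\<^sub>2\<bar> * S \<le> real (card X) * P ^ 2 * M ^ 2"
  shows "(\<Sum>x\<in>X. (c x - q / P) ^ 2) * S \<le> 3 * real (card X) * M ^ 2"
proof -
  have "E\<^sub>2 - 2 * q * E\<^sub>1 \<le> \<bar>E\<^sub>2\<bar> + 2 * q * \<bar>E\<^sub>1\<bar>"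
    using mult_left_mono[OF abs_ge_minus_self, of "2 * q" E\<^sub>1] assms(3) by linarith
  then have "(E\<^sub>2 - 2 * q * E\<^sub>1) * S \<le> \<bar>E\<^sub>2\<bar> * S + 2 * q * (\<bar>E\<^sub>1\<bar> * S)"
    using mult_right_mono[OF _ assms(5)] by (fastforce simp: distrib_right mult.assoc)
  also have "\<dots> \<le> real (card X) * P ^ 2 * M ^ 2 + 2 * M * (real (card X) * P * M)"
    using assms(3-5) by (intro add_mono[OF E\<^sub>2] mult_mono[OF _ E\<^sub>1]) simp_all
  also have "\<dots> \<le> 3 * real (card X) * M ^ 2 * P ^ 2"
  proof -
    have "real (card X) * P * M ^ 2 \<le> real (card X) * P ^ 2 * M ^ 2"
      using assms(2) by (intro mult_right_mono mult_left_mono) (simp_all add: power2_eq_square)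
    then show ?thesis by (simp add: power2_eq_square algebra_simps)
  qed
  finally show ?thesis
    using assms(2) by (simp add: sum_square_deviation_eq[OF assms(1) _ assms(6,7)] divide_le_eq)
qed

lemma card_abs_ge_mult_square_le:
  fixes g :: "'a \<Rightarrow> real" and t :: real
  assumes "finite X" "0 \<le> t"
  shows "real (card {x\<in>X. t \<le> \<bar>g x\<bar>}) * t ^ 2 \<le> (\<Sum>x\<in>X. g x ^ 2)"
proof -
  have "real (card {x\<in>X. t \<le> \<bar>g x\<bar>}) * t ^ 2 = (\<Sum>x\<in>{x\<in>X. t \<le> \<bar>g x\<bar>}. t ^ 2)" by simp
  also have "\<dots> \<le> (\<Sum>x\<in>{x\<in>X. t \<le> \<bar>g x\<bar>}. g x ^ 2)"
    using assms(2) by (intro sum_mono) (metis mem_Collect_eq power2_abs power_mono)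
  also have "\<dots> \<le> (\<Sum>x\<in>X. g x ^ 2)" using assms(1) by (intro sum_mono2) auto
  finally show ?thesis .
qed

section \<open>Common zeros of a bilinear map on a coset\<close>

locale bilinear_subspace =
  fixes \<beta> :: "'f::{field,finite}^'n \<Rightarrow> 'f^'n \<Rightarrow> 'f^'r" and V :: "('f^'n) set"
  assumes bilinear: "bilinear_map \<beta>" and subspace: "vec.subspace V"
begin

lemma linear_left: "Vector_Spaces.linear (*s) (*s) (\<lambda>x. \<beta> x y)"
  using bilinear unfolding bilinear_map_def by blast

lemma linear_right: "Vector_Spaces.linear (*s) (*s) (\<lambda>y. \<beta> x y)"
  using bilinear unfolding bilinear_map_def by blast

lemma add_left: "\<beta> (x + x') y = \<beta> x y + \<beta> x' y"
  using vec.linear_add[OF linear_left] .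

lemma add_right: "\<beta> x (y + y') = \<beta> x y + \<beta> x y'"
  using vec.linear_add[OF linear_right] .

lemma diff_left: "\<beta> (x - x') y = \<beta> x y - \<beta> x' y"
  using vec.linear_diff[OF linear_left] .

lemma diff_right: "\<beta> x (y - y') = \<beta> x y - \<beta> x y'"
  using vec.linear_diff[OF linear_right] .

lemma scale_left: "\<beta> (c *s x) y = c *s \<beta> x y"
  using vec.linear_scale[OF linear_left] .

lemma scale_right: "\<beta> x (c *s y) = c *s \<beta> x y"
  using vec.linear_scale[OF linear_right] .

lemma zero_left [simp]: "\<beta> 0 y = 0"
  using vec.linear_0[OF linear_left] .

lemma zero_in_V: "0 \<in> V"
  using subspace by (rule vec.subspace_0)

lemma add_in_V: "u \<in> V \<Longrightarrow> v \<in> V \<Longrightarrow> u + v \<in> V"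
  using subspace by (rule vec.subspace_add)

lemma diff_in_V: "u \<in> V \<Longrightarrow> v \<in> V \<Longrightarrow> u - v \<in> V"
  using subspace by (rule vec.subspace_diff)

lemma scale_in_V: "u \<in> V \<Longrightarrow> c *s u \<in> V"
  using subspace by (rule vec.subspace_scale)

lemma card_V_pos: "card V > 0"
  using zero_in_V by (auto simp: card_gt_0_iff)

lemma card_right_radical_le:
  assumes "bilinear_rank_at_least V \<beta> s" "l \<noteq> 0"
  shows "card {w\<in>V. \<forall>v\<in>V. dotp l (\<beta> v w) = 0} * CARD('f) ^ s \<le> card V"
proof -
  let ?L = "{v\<in>V. \<forall>w\<in>V. dotp l (\<beta> v w) = 0}"
  let ?R = "{w\<in>V. \<forall>v\<in>V. dotp l (\<beta> v w) = 0}"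
  \<comment> \<open>The rank is defined through the left radical; counting transfers the bound to the right one.\<close>
  have "card V * card ?R = card V * card ?L"
    by (rule card_mult_card_right_radical_eq[where scale\<^sub>U="(*s)" and scale\<^sub>W="(*s)"])
      (simp_all add: add_in_V diff_in_V scale_in_V add_left add_right scale_left scale_right
        dotp_add_right dotp_scale_right)
  then have "card ?R = card ?L" using card_V_pos by (simp only: mult_left_cancel neq0_conv)
  have "vec.subspace ?L"
    unfolding vec.subspace_def by (simp add: zero_in_V add_in_V scale_in_V add_left scale_left
      dotp_add_right dotp_scale_right)
  have "s \<le> vec.dim V - vec.dim ?L"
    using assms unfolding bilinear_rank_at_least_def form_rank_on_def by blast
  moreover have "vec.dim ?L \<le> vec.dim V" by (rule vec.dim_subset) auto
  ultimately have "CARD('f) ^ (vec.dim ?L + s) \<le> CARD('f) ^ vec.dim V"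
    by (intro power_increasing) auto
  then show ?thesis
    using \<open>card ?R = card ?L\<close> vec.card_subspace[OF _ _ \<open>vec.subspace ?L\<close>]
      vec.card_subspace[OF _ _ subspace]
    by (simp add: power_add)
qed

lemma card_annihilating_tuples_le:
  assumes "bilinear_rank_at_least V \<beta> s" "j0 < m" "\<Lambda> j0 \<noteq> 0"
  shows "card {zs \<in> tuples (coset b V) m. \<forall>v\<in>V. (\<Sum>j<m. dotp (\<Lambda> j) (\<beta> v (zs ! j))) = 0}
           * CARD('f) ^ s \<le> card V ^ m"
proof -
  let ?R = "{w\<in>V. \<forall>v\<in>V. dotp (\<Lambda> j0) (\<beta> v w) = 0}"
  let ?P = "\<lambda>zs. \<forall>v\<in>V. (\<Sum>j<m. dotp (\<Lambda> j) (\<beta> v (zs ! j))) = 0"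
  \<comment> \<open>With the other coordinates fixed, the admissible \<open>zs ! j0\<close> differ by elements of \<open>?R\<close>.\<close>
  have slice: "card {y \<in> coset b V. ?P (ws[j0:=y])} \<le> card ?R"
    if "ws \<in> tuples (coset b V) m" for ws
  proof (rule card_le_card_if_diffs_in)
    define C where "C v = (\<Sum>j\<in>{..<m}-{j0}. dotp (\<Lambda> j) (\<beta> v (ws ! j)))" for v
    have "length ws = m" using that by (simp add: tuples_def)
    then have split: "(\<Sum>j<m. dotp (\<Lambda> j) (\<beta> v (ws[j0:=y] ! j))) = dotp (\<Lambda> j0) (\<beta> v y) + C v"
      for v y using \<open>j0 < m\<close> unfolding C_def
      by (subst sum.remove[of _ j0]) (auto intro!: sum.cong)
    fix y y' assume "y \<in> {y \<in> coset b V. ?P (ws[j0:=y])}" "y' \<in> {y \<in> coset b V. ?P (ws[j0:=y])}"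
    then have "y - b \<in> V" "y' - b \<in> V"
      and zero: "\<forall>v\<in>V. dotp (\<Lambda> j0) (\<beta> v y) + C v = 0" "\<forall>v\<in>V. dotp (\<Lambda> j0) (\<beta> v y') + C v = 0"
      by (auto simp: mem_coset_iff split)
    moreover have "y - y' = (y - b) - (y' - b)" by simp
    ultimately have "y - y' \<in> V" by (metis diff_in_V)
    with zero show "y - y' \<in> ?R"
      by (auto simp: diff_right dotp_diff_right eq_neg_iff_add_eq_0[symmetric])
  qed simp
  have "card {zs \<in> tuples (coset b V) m. ?P zs} * card V * CARD('f) ^ s
      \<le> card V ^ m * card ?R * CARD('f) ^ s"
    using card_tuples_by_slices[OF _ \<open>j0 < m\<close> slice] by (simp add: card_coset)
  also have "\<dots> \<le> card V ^ m * card V"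
    using card_right_radical_le[OF assms(1,3)] by (simp add: mult.assoc)
  finally show ?thesis using card_V_pos by (simp add: ac_simps)
qed

definition eval_map :: "('f^'n) list \<Rightarrow> 'f^'n \<Rightarrow> nat \<Rightarrow> 'f^'r" where
  "eval_map zs v = (\<lambda>j. if j < length zs then \<beta> v (zs ! j) else 0)"

definition annihilator :: "('f^'n) list \<Rightarrow> (nat \<Rightarrow> 'f^'r) set" where
  "annihilator zs =
     {\<Lambda>\<in>coeff_space (length zs). \<forall>v\<in>V. pairing (length zs) \<Lambda> (eval_map zs v) = 0}"

definition common_zeros :: "'f^'n \<Rightarrow> ('f^'n) list \<Rightarrow> ('f^'n) set" where
  "common_zeros a zs = {x\<in>coset a V. \<forall>z\<in>set zs. \<beta> x z = 0}"

lemma eval_map_add: "eval_map zs (u + v) = eval_map zs u + eval_map zs v"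
  by (auto simp: eval_map_def fun_eq_iff add_left)

lemma eval_map_diff: "eval_map zs (u - v) = eval_map zs u - eval_map zs v"
  by (auto simp: eval_map_def fun_eq_iff diff_left)

lemma eval_map_scale: "eval_map zs (c *s v) = (\<lambda>j. c *s eval_map zs v j)"
  by (auto simp: eval_map_def fun_eq_iff scale_left)

lemma eval_map_eq_0_iff: "eval_map zs v = 0 \<longleftrightarrow> (\<forall>z\<in>set zs. \<beta> v z = 0)"
  by (auto simp: eval_map_def fun_eq_iff all_set_conv_all_nth)

lemma finite_annihilator: "finite (annihilator zs)"
  using finite_coeff_space by (rule finite_subset[rotated]) (auto simp: annihilator_def)

lemma zero_in_annihilator: "0 \<in> annihilator zs"
  by (simp add: annihilator_def coeff_space_def pairing_def)

lemma card_coeff_space_eq_card_image_mult_card_annihilator: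
  "card (coeff_space (length zs) :: (nat \<Rightarrow> 'f^'r) set)
     = card (eval_map zs ` V) * card (annihilator zs)"
proof -
  have "card (coeff_space (length zs) :: (nat \<Rightarrow> 'f^'r) set)
      = card (eval_map zs ` V)
        * card {\<Lambda>\<in>coeff_space (length zs). \<forall>w\<in>eval_map zs ` V. pairing (length zs) \<Lambda> w = 0}"
  proof (rule card_coeff_space_eq_card_mult_card_annihilator)
    show "eval_map zs ` V \<subseteq> coeff_space (length zs)" by (auto simp: coeff_space_def eval_map_def)
    show "0 \<in> eval_map zs ` V"
      using zero_in_V by (auto intro!: image_eqI[where x=0] simp: eval_map_def fun_eq_iff)
    show "u + w \<in> eval_map zs ` V" if "u \<in> eval_map zs ` V" "w \<in> eval_map zs ` V" for u w
      using that by (auto simp: eval_map_add[symmetric] add_in_V)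
    show "u - w \<in> eval_map zs ` V" if "u \<in> eval_map zs ` V" "w \<in> eval_map zs ` V" for u w
      using that by (auto simp: eval_map_diff[symmetric] diff_in_V)
    show "(\<lambda>j. c *s u j) \<in> eval_map zs ` V" if "u \<in> eval_map zs ` V" for c u
      using that by (auto simp: eval_map_scale[symmetric] scale_in_V)
  qed
  also have "{\<Lambda>\<in>coeff_space (length zs). \<forall>w\<in>eval_map zs ` V. pairing (length zs) \<Lambda> w = 0}
      = annihilator zs"
    by (auto simp: annihilator_def)
  finally show ?thesis .
qed

lemma card_common_zeros:
  assumes "common_zeros a zs \<noteq> {}"
  shows "card (common_zeros a zs) * CARD('f) ^ (CARD('r) * length zs)
           = card V * card (annihilator zs)"
proof -
  let ?K = "{v\<in>V. eval_map zs v = 0}"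
  obtain x0 where x0: "x0 \<in> common_zeros a zs" using assms by blast
  have "common_zeros a zs = (+) x0 ` ?K"
  proof
    show "common_zeros a zs \<subseteq> (+) x0 ` ?K"
    proof
      fix x assume x: "x \<in> common_zeros a zs"
      have "x - x0 \<in> V"
        using diff_in_V[of "x - a" "x0 - a"] x x0 by (simp add: common_zeros_def mem_coset_iff)
      with x x0 have "x - x0 \<in> ?K"
        by (simp add: common_zeros_def eval_map_eq_0_iff diff_left)
      then show "x \<in> (+) x0 ` ?K" by (auto intro!: image_eqI[where x="x - x0"])
    qed
    show "(+) x0 ` ?K \<subseteq> common_zeros a zs"
    proof clarify
      fix v assume "v \<in> V" "eval_map zs v = 0"
      moreover have "x0 + v - a \<in> V"
        using x0 add_in_V[of "x0 - a" v] \<open>v \<in> V\<close>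
        by (simp add: common_zeros_def mem_coset_iff diff_add_eq)
      ultimately show "x0 + v \<in> common_zeros a zs"
        using x0 by (auto simp: common_zeros_def mem_coset_iff eval_map_eq_0_iff add_left)
    qed
  qed
  then have "card (common_zeros a zs) = card ?K" by (simp add: card_image)
  moreover have "card V = card (eval_map zs ` V) * card ?K"
    by (rule card_eq_card_image_mult_card_kernel) (auto simp: add_in_V diff_in_V eval_map_add)
  ultimately show ?thesis
    using card_coeff_space_eq_card_image_mult_card_annihilator[of zs]
    by (simp add: card_coeff_space)
qed

lemma two_le_card_annihilator:
  assumes "common_zeros a zs = {}"
  shows "2 \<le> card (annihilator zs)"
proof (rule ccontr)
  assume "\<not> 2 \<le> card (annihilator zs)"
  moreover have "card (annihilator zs) \<noteq> 0"
    using finite_annihilator zero_in_annihilator by auto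
  ultimately have "card (annihilator zs) = 1" by simp
  then have "card (eval_map zs ` V) = card (coeff_space (length zs) :: (nat \<Rightarrow> 'f^'r) set)"
    using card_coeff_space_eq_card_image_mult_card_annihilator[of zs] by simp
  then have image: "eval_map zs ` V = coeff_space (length zs)"
    by (intro card_subset_eq finite_coeff_space) (auto simp: coeff_space_def eval_map_def)
  have "(\<lambda>j. if j < length zs then - \<beta> a (zs ! j) else 0) \<in> coeff_space (length zs)"
    by (simp add: coeff_space_def)
  then obtain v where "v \<in> V"
    and v: "eval_map zs v = (\<lambda>j. if j < length zs then - \<beta> a (zs ! j) else 0)"
    unfolding image[symmetric] by auto
  have "\<beta> (a + v) z = 0" if z: "z \<in> set zs" for z
  proof -
    obtain j where "j < length zs" "z = zs ! j" using z by (auto simp: in_set_conv_nth)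
    with fun_cong[OF v, of j] show ?thesis by (simp add: eval_map_def add_left)
  qed
  moreover have "a + v \<in> coset a V" using \<open>v \<in> V\<close> by (simp add: mem_coset_iff)
  ultimately have "a + v \<in> common_zeros a zs" by (simp add: common_zeros_def)
  with assms show False by simp
qed

definition count_error :: "'f^'n \<Rightarrow> nat \<Rightarrow> ('f^'n) list \<Rightarrow> real" where
  "count_error a d zs =
     real (card (common_zeros a zs)) ^ d * real CARD('f) ^ (CARD('r) * length zs * d)
     - real (card V) ^ d"

lemma one_le_card_annihilator: "1 \<le> card (annihilator zs)"
  using finite_annihilator zero_in_annihilator by (simp add: Suc_le_eq card_gt_0_iff) blast

lemma abs_count_error_le:
  assumes "d > 0"
  shows "\<bar>count_error a d zs\<bar> \<le> real (card V) ^ d * (real (card (annihilator zs)) ^ d - 1)"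
proof (cases "common_zeros a zs = {}")
  case True
  have "2 ^ 1 \<le> real (card (annihilator zs)) ^ d"
    using two_le_card_annihilator[OF True] assms
    by (intro order.trans[OF power_increasing power_mono]) auto
  then have "real (card V) ^ d * 1 \<le> real (card V) ^ d * (real (card (annihilator zs)) ^ d - 1)"
    by (intro mult_left_mono) simp_all
  with True assms show ?thesis by (simp add: count_error_def power_0_left)
next
  case False
  have "real (card (common_zeros a zs)) ^ d * real CARD('f) ^ (CARD('r) * length zs * d)
      = (real (card (common_zeros a zs) * CARD('f) ^ (CARD('r) * length zs))) ^ d"
    by (simp add: power_mult_distrib power_mult)
  also have "\<dots> = real (card V) ^ d * real (card (annihilator zs)) ^ d"
    unfolding card_common_zeros[OF False] by (simp add: power_mult_distrib)
  finally have "count_error a d zs = real (card V) ^ d * (real (card (annihilator zs)) ^ d - 1)"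
    by (simp add: count_error_def right_diff_distrib)
  moreover have "1 \<le> real (card (annihilator zs)) ^ d"
    using one_le_card_annihilator by simp
  ultimately show ?thesis by simp
qed

lemma card_tuples_annihilated_le:
  assumes "bilinear_rank_at_least V \<beta> s" "\<Lambda> \<in> coeff_space m" "\<Lambda> \<noteq> 0"
  shows "card {zs\<in>tuples (coset b V) m. \<Lambda> \<in> annihilator zs} * CARD('f) ^ s \<le> card V ^ m"
proof -
  obtain j0 where "\<Lambda> j0 \<noteq> 0" using assms(3) by (auto simp: fun_eq_iff)
  with assms(2) have "j0 < m" by (auto simp: coeff_space_def not_less[symmetric])
  have "{zs\<in>tuples (coset b V) m. \<Lambda> \<in> annihilator zs}
      \<subseteq> {zs\<in>tuples (coset b V) m. \<forall>v\<in>V. (\<Sum>j<m. dotp (\<Lambda> j) (\<beta> v (zs ! j))) = 0}"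
    by (auto simp: tuples_def annihilator_def pairing_def eval_map_def)
  then have "card {zs\<in>tuples (coset b V) m. \<Lambda> \<in> annihilator zs}
      \<le> card {zs\<in>tuples (coset b V) m. \<forall>v\<in>V. (\<Sum>j<m. dotp (\<Lambda> j) (\<beta> v (zs ! j))) = 0}"
    by (intro card_mono) (simp_all add: finite_tuples)
  with card_annihilating_tuples_le[where \<Lambda>=\<Lambda> and b=b, OF assms(1) \<open>j0 < m\<close> \<open>\<Lambda> j0 \<noteq> 0\<close>]
  show ?thesis by (meson le_trans mult_le_mono1)
qed

lemma card_annihilator_pow_minus_one:
  assumes "length zs = m"
  shows "card (annihilator zs) ^ d - 1
           = card {Ls\<in>tuples (coeff_space m) d - {replicate d 0}. set Ls \<subseteq> annihilator zs}"
proof -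
  have "annihilator zs \<subseteq> coeff_space m" using assms by (auto simp: annihilator_def)
  then have "{Ls\<in>tuples (coeff_space m) d - {replicate d 0}. set Ls \<subseteq> annihilator zs}
      = tuples (annihilator zs) d - {replicate d 0}"
    by (auto simp: tuples_def)
  moreover have "replicate d 0 \<in> tuples (annihilator zs) d"
    using zero_in_annihilator by (simp add: tuples_def set_replicate_conv_if)
  ultimately show ?thesis by (simp add: card_Diff_singleton card_tuples finite_annihilator)
qed

lemma sum_card_annihilator_pow_le:
  assumes "bilinear_rank_at_least V \<beta> s"
  shows "(\<Sum>zs\<in>tuples (coset b V) m. card (annihilator zs) ^ d - 1) * CARD('f) ^ s
           \<le> CARD('f) ^ (CARD('r) * m * d) * card V ^ m"
proof -
  let ?Ls = "tuples (coeff_space m :: (nat \<Rightarrow> 'f^'r) set) d - {replicate d 0}"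
  have "finite ?Ls" by (simp add: finite_tuples finite_coeff_space)
  have "(\<Sum>zs\<in>tuples (coset b V) m. card (annihilator zs) ^ d - 1)
      = (\<Sum>zs\<in>tuples (coset b V) m. card {Ls\<in>?Ls. set Ls \<subseteq> annihilator zs})"
    by (intro sum.cong refl card_annihilator_pow_minus_one) (simp add: tuples_def)
  also have "\<dots> = (\<Sum>Ls\<in>?Ls. card {zs\<in>tuples (coset b V) m. set Ls \<subseteq> annihilator zs})"
    by (rule sum_card_swap[OF finite_tuples[OF finite] \<open>finite ?Ls\<close>])
  finally have "(\<Sum>zs\<in>tuples (coset b V) m. card (annihilator zs) ^ d - 1) * CARD('f) ^ s
      = (\<Sum>Ls\<in>?Ls. card {zs\<in>tuples (coset b V) m. set Ls \<subseteq> annihilator zs} * CARD('f) ^ s)"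
    by (simp add: sum_distrib_right)
  also have "\<dots> \<le> (\<Sum>Ls\<in>?Ls. card V ^ m)"
  proof (rule sum_mono)
    fix Ls assume Ls: "Ls \<in> ?Ls"
    then have "\<exists>\<Lambda>\<in>set Ls. \<Lambda> \<noteq> 0"
      using replicate_length_same[of Ls 0] by (fastforce simp: tuples_def)
    then obtain \<Lambda> where "\<Lambda> \<in> set Ls" "\<Lambda> \<noteq> 0" by blast
    then have "\<Lambda> \<in> coeff_space m" using Ls by (auto simp: tuples_def)
    have "card {zs\<in>tuples (coset b V) m. set Ls \<subseteq> annihilator zs}
        \<le> card {zs\<in>tuples (coset b V) m. \<Lambda> \<in> annihilator zs}"
      using \<open>\<Lambda> \<in> set Ls\<close> by (intro card_mono) (auto simp: finite_tuples)
    with card_tuples_annihilated_le[where b=b, OF assms \<open>\<Lambda> \<in> coeff_space m\<close> \<open>\<Lambda> \<noteq> 0\<close>]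
    show "card {zs\<in>tuples (coset b V) m. set Ls \<subseteq> annihilator zs} * CARD('f) ^ s \<le> card V ^ m"
      by (meson le_trans mult_le_mono1)
  qed
  also have "\<dots> \<le> card (tuples (coeff_space m :: (nat \<Rightarrow> 'f^'r) set) d) * card V ^ m"
    by (simp add: card_mono finite_tuples finite_coeff_space)
  also have "\<dots> = CARD('f) ^ (CARD('r) * m * d) * card V ^ m"
    by (simp add: card_tuples finite_coeff_space card_coeff_space power_mult)
  finally show ?thesis .
qed

lemma sum_abs_count_error_le:
  assumes "bilinear_rank_at_least V \<beta> s" "d > 0"
  shows "(\<Sum>zs\<in>tuples (coset b V) m. \<bar>count_error a d zs\<bar>) * real CARD('f) ^ s
           \<le> real (card V) ^ d * real CARD('f) ^ (CARD('r) * m * d) * real (card V) ^ m"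
proof -
  let ?S = "\<Sum>zs\<in>tuples (coset b V) m. card (annihilator zs) ^ d - 1"
  have "real (card (annihilator zs) ^ d - 1) = real (card (annihilator zs)) ^ d - 1" for zs
    using one_le_card_annihilator[of zs] by simp
  then have "(\<Sum>zs\<in>tuples (coset b V) m. \<bar>count_error a d zs\<bar>) \<le> real (card V) ^ d * real ?S"
    unfolding of_nat_sum sum_distrib_left by (auto intro!: sum_mono abs_count_error_le assms(2))
  then have "(\<Sum>zs\<in>tuples (coset b V) m. \<bar>count_error a d zs\<bar>) * real CARD('f) ^ s
      \<le> real (card V) ^ d * real (?S * CARD('f) ^ s)"
    by (simp add: mult_right_mono mult.assoc)
  also have "\<dots> \<le> real (card V) ^ d * real (CARD('f) ^ (CARD('r) * m * d) * card V ^ m)"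
    by (intro mult_left_mono of_nat_mono sum_card_annihilator_pow_le assms(1)) simp
  finally show ?thesis by (simp add: mult.assoc)
qed

lemma sum_card_orthogonal_eq:
  assumes "finite I"
  shows "(\<Sum>xs\<in>tuples (coset a V) d. card {i\<in>I. \<forall>x\<in>set xs. \<forall>y\<in>set (f i). \<beta> x y = 0})
           = (\<Sum>i\<in>I. card (common_zeros a (f i)) ^ d)"
proof -
  have "{xs\<in>tuples (coset a V) d. \<forall>x\<in>set xs. \<forall>y\<in>set (f i). \<beta> x y = 0}
      = tuples (common_zeros a (f i)) d" for i
    by (auto simp: tuples_def common_zeros_def)
  moreover have "(\<Sum>xs\<in>tuples (coset a V) d. card {i\<in>I. \<forall>x\<in>set xs. \<forall>y\<in>set (f i). \<beta> x y = 0})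
      = (\<Sum>i\<in>I. card {xs\<in>tuples (coset a V) d. \<forall>x\<in>set xs. \<forall>y\<in>set (f i). \<beta> x y = 0})"
    by (rule sum_card_swap[OF finite_tuples[OF finite] assms])
  ultimately show ?thesis by (simp add: card_tuples finite_subset[OF _ finite])
qed

lemma sum_card_orthogonal_mult_eq:
  assumes "finite I" "\<And>i. i \<in> I \<Longrightarrow> length (f i) = m"
  shows "(\<Sum>xs\<in>tuples (coset a V) d. real (card {i\<in>I. \<forall>x\<in>set xs. \<forall>y\<in>set (f i). \<beta> x y = 0}))
           * real CARD('f) ^ (CARD('r) * m * d)
         = real (card I) * real (card V) ^ d + (\<Sum>i\<in>I. count_error a d (f i))"
proof -
  have "(\<Sum>xs\<in>tuples (coset a V) d. real (card {i\<in>I. \<forall>x\<in>set xs. \<forall>y\<in>set (f i). \<beta> x y = 0}))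
      = (\<Sum>i\<in>I. real (card (common_zeros a (f i))) ^ d)"
    by (simp only: of_nat_power[symmetric] of_nat_sum[symmetric]
        sum_card_orthogonal_eq[OF assms(1)])
  then show ?thesis
    using assms(2) by (simp add: sum_distrib_right count_error_def sum_subtractf)
qed

lemma sum_square_card_orthogonal_mult_eq:
  assumes "finite Q" "\<And>ys. ys \<in> Q \<Longrightarrow> length ys = k"
  shows "(\<Sum>xs\<in>tuples (coset a V) d. real (card {ys\<in>Q. \<forall>x\<in>set xs. \<forall>y\<in>set ys. \<beta> x y = 0}) ^ 2)
           * real CARD('f) ^ (CARD('r) * (k + k) * d)
         = real (card Q) ^ 2 * real (card V) ^ d + (\<Sum>pq\<in>Q \<times> Q. count_error a d (fst pq @ snd pq))"
proof -
  have "{pq\<in>Q \<times> Q. \<forall>x\<in>set xs. \<forall>y\<in>set (fst pq @ snd pq). \<beta> x y = 0}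
      = {ys\<in>Q. \<forall>x\<in>set xs. \<forall>y\<in>set ys. \<beta> x y = 0} \<times> {ys\<in>Q. \<forall>x\<in>set xs. \<forall>y\<in>set ys. \<beta> x y = 0}"
    for xs by auto
  then show ?thesis
    using sum_card_orthogonal_mult_eq[where I="Q \<times> Q" and f="\<lambda>pq. fst pq @ snd pq" and m="k + k"]
      assms
    by (auto simp: power2_eq_square card_cartesian_product)
qed

lemma abs_sum_count_error_le:
  assumes "bilinear_rank_at_least V \<beta> s" "d > 0"
    and "inj_on f I" "f ` I \<subseteq> tuples (coset b V) m"
  shows "\<bar>\<Sum>i\<in>I. count_error a d (f i)\<bar> * real CARD('f) ^ s
           \<le> real (card V) ^ d * real CARD('f) ^ (CARD('r) * m * d) * real (card V) ^ m"
proof -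
  have "\<bar>\<Sum>i\<in>I. count_error a d (f i)\<bar> \<le> (\<Sum>zs\<in>f ` I. \<bar>count_error a d zs\<bar>)"
    using sum_abs[of "\<lambda>i. count_error a d (f i)" I] by (simp add: sum.reindex[OF assms(3)])
  also have "\<dots> \<le> (\<Sum>zs\<in>tuples (coset b V) m. \<bar>count_error a d zs\<bar>)"
    using assms(4) by (intro sum_mono2 finite_tuples) auto
  finally show ?thesis
    using sum_abs_count_error_le[OF assms(1,2), where b=b and m=m and a=a]
    by (meson mult_right_mono order.trans zero_le_power of_nat_0_le_iff)
qed

lemma abs_sum_count_error_append_le:
  assumes "bilinear_rank_at_least V \<beta> s" "d > 0" "Q \<subseteq> tuples (coset b V) k"
  shows "\<bar>\<Sum>pq\<in>Q \<times> Q. count_error a d (fst pq @ snd pq)\<bar> * real CARD('f) ^ s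
           \<le> real (card V) ^ d * real CARD('f) ^ (CARD('r) * (k + k) * d) * (real (card V) ^ k) ^ 2"
proof -
  have "inj_on (\<lambda>pq. fst pq @ snd pq) (Q \<times> Q)"
    by (auto simp: inj_on_def tuples_def dest!: subsetD[OF assms(3)])
  moreover have "(\<lambda>pq. fst pq @ snd pq) ` (Q \<times> Q) \<subseteq> tuples (coset b V) (k + k)"
    by (auto simp: tuples_def dest!: subsetD[OF assms(3)])
  ultimately show ?thesis
    unfolding power2_eq_square power_add[symmetric] by (rule abs_sum_count_error_le[OF assms(1,2)])
qed

lemma sum_square_count_deviation_le:
  assumes "bilinear_rank_at_least V \<beta> s" "d > 0" "Q \<subseteq> tuples (coset b V) k"
  shows "(\<Sum>xs\<in>tuples (coset a V) d.
            (real (card {ys\<in>Q. \<forall>x\<in>set xs. \<forall>y\<in>set ys. \<beta> x y = 0})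
              - real (card Q) / real CARD('f) ^ (CARD('r) * k * d)) ^ 2) * real CARD('f) ^ s
         \<le> 3 * real (card V) ^ d * (real (card V) ^ k) ^ 2"
proof -
  have "finite Q" using assms(3) finite_tuples[OF finite] by (rule finite_subset)
  have length: "length ys = k" if "ys \<in> Q" for ys using that assms(3) by (auto simp: tuples_def)
  have P_square:
    "real CARD('f) ^ (CARD('r) * (k + k) * d) = (real CARD('f) ^ (CARD('r) * k * d)) ^ 2"
  proof -
    have "CARD('r) * (k + k) * d = CARD('r) * k * d * 2" by simp
    then show ?thesis by (simp only: power_mult)
  qed
  have card_X: "real (card (tuples (coset a V) d)) = real (card V) ^ d"
    by (simp add: card_tuples card_coset)
  show ?thesis
    unfolding card_X[symmetric]
  proof (rule sum_square_deviation_le[where E\<^sub>1="\<Sum>ys\<in>Q. count_error a d ys"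
        and E\<^sub>2="\<Sum>pq\<in>Q \<times> Q. count_error a d (fst pq @ snd pq)"])
    show "real (card Q) \<le> real (card V) ^ k"
      using card_mono[OF finite_tuples[OF finite] assms(3)] by (simp add: card_tuples card_coset)
    show "(\<Sum>xs\<in>tuples (coset a V) d. real (card {ys\<in>Q. \<forall>x\<in>set xs. \<forall>y\<in>set ys. \<beta> x y = 0}))
        * real CARD('f) ^ (CARD('r) * k * d)
        = real (card Q) * real (card (tuples (coset a V) d)) + (\<Sum>ys\<in>Q. count_error a d ys)"
      using sum_card_orthogonal_mult_eq[OF \<open>finite Q\<close>, where f=id and m=k] length
      by (simp add: card_X)
    show "(\<Sum>xs\<in>tuples (coset a V) d. real (card {ys\<in>Q. \<forall>x\<in>set xs. \<forall>y\<in>set ys. \<beta> x y = 0}) ^ 2)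
        * (real CARD('f) ^ (CARD('r) * k * d)) ^ 2
        = real (card Q) ^ 2 * real (card (tuples (coset a V) d))
          + (\<Sum>pq\<in>Q \<times> Q. count_error a d (fst pq @ snd pq))"
      unfolding P_square[symmetric] card_X
      by (rule sum_square_card_orthogonal_mult_eq[OF \<open>finite Q\<close> length])
    show "\<bar>\<Sum>ys\<in>Q. count_error a d ys\<bar> * real CARD('f) ^ s
        \<le> real (card (tuples (coset a V) d)) * real CARD('f) ^ (CARD('r) * k * d)
          * real (card V) ^ k"
      using abs_sum_count_error_le[OF assms(1,2), where f=id and I=Q and m=k] assms(3)
      by (simp add: card_X)
    show "\<bar>\<Sum>pq\<in>Q \<times> Q. count_error a d (fst pq @ snd pq)\<bar> * real CARD('f) ^ s
        \<le> real (card (tuples (coset a V) d)) * (real CARD('f) ^ (CARD('r) * k * d)) ^ 2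
          * (real (card V) ^ k) ^ 2"
      using abs_sum_count_error_append_le[OF assms] by (simp add: card_X P_square)
  qed (simp_all add: finite_tuples)
qed

lemma card_deviating_tuples_le:
  assumes "bilinear_rank_at_least V \<beta> s" "d > 0" "Q \<subseteq> tuples (coset b V) k" "\<eta> > 0"
  shows "real (card {xs\<in>tuples (coset a V) d. \<eta> * real (card V) ^ k
            \<le> \<bar>real (card {ys\<in>Q. \<forall>x\<in>set xs. \<forall>y\<in>set ys. \<beta> x y = 0})
               - real (card Q) / real CARD('f) ^ (CARD('r) * k * d)\<bar>}) * \<eta> ^ 2 * real CARD('f) ^ s
         \<le> 3 * real (card V) ^ d"
proof -
  let ?B = "{xs\<in>tuples (coset a V) d. \<eta> * real (card V) ^ k
      \<le> \<bar>real (card {ys\<in>Q. \<forall>x\<in>set xs. \<forall>y\<in>set ys. \<beta> x y = 0})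
         - real (card Q) / real CARD('f) ^ (CARD('r) * k * d)\<bar>}"
  have "real (card ?B) * (\<eta> * real (card V) ^ k) ^ 2
      \<le> (\<Sum>xs\<in>tuples (coset a V) d.
            (real (card {ys\<in>Q. \<forall>x\<in>set xs. \<forall>y\<in>set ys. \<beta> x y = 0})
              - real (card Q) / real CARD('f) ^ (CARD('r) * k * d)) ^ 2)"
    using assms(4) by (intro card_abs_ge_mult_square_le finite_tuples) simp_all
  then have "real (card ?B) * (\<eta> * real (card V) ^ k) ^ 2 * real CARD('f) ^ s
      \<le> 3 * real (card V) ^ d * (real (card V) ^ k) ^ 2"
    using sum_square_count_deviation_le[OF assms(1-3)]
    by (meson mult_right_mono order.trans zero_le_power of_nat_0_le_iff)
  then have "(real (card ?B) * \<eta> ^ 2 * real CARD('f) ^ s) * (real (card V) ^ k) ^ 2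
      \<le> (3 * real (card V) ^ d) * (real (card V) ^ k) ^ 2"
    by (simp add: power_mult_distrib ac_simps)
  then show ?thesis using card_V_pos by (auto simp: mult_le_cancel_right)
qed

end

theorem lemma2p7:
  fixes \<beta> :: "'f::{field,finite}^'n \<Rightarrow> 'f^'n \<Rightarrow> 'f^'r"
    and V :: "('f^'n) set" and a b :: "'f^'n"
    and Q :: "('f^'n) list set"
    and k d s :: nat and \<delta> \<eta> :: real
  assumes "prime (CARD('f))"
    and "vec.subspace V"
    and "bilinear_map \<beta>"
    and "bilinear_rank_at_least V \<beta> s"
    and "k > 0" and "d > 0"
    and "Q \<subseteq> {ys. length ys = k \<and> set ys \<subseteq> coset b V}"
    and "real (card Q) = \<delta> * real (card V) ^ k"
    and "\<eta> > 0"
  shows "real (card {xs. length xs = d \<and> set xs \<subseteq> coset a V \<and>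
            \<bar>real (card {ys \<in> Q. \<forall>x\<in>set xs. \<forall>y\<in>set ys. \<beta> x y = 0})
              - \<delta> * real (CARD('f)) powr (- real (k * d * CARD('r))) * real (card V) ^ k\<bar>
            \<ge> \<eta> * real (card V) ^ k})
         / real (card V) ^ d
       \<le> 3 * \<eta> powr (-2) * real (CARD('f)) powr (- real s / 4)"
proof -
  interpret bilinear_subspace \<beta> V using assms(2,3) by unfold_locales
  let ?B = "{xs. length xs = d \<and> set xs \<subseteq> coset a V \<and>
            \<bar>real (card {ys \<in> Q. \<forall>x\<in>set xs. \<forall>y\<in>set ys. \<beta> x y = 0})
              - \<delta> * real (CARD('f)) powr (- real (k * d * CARD('r))) * real (card V) ^ k\<bar>
            \<ge> \<eta> * real (card V) ^ k}"
  define p where "p = real CARD('f)"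
  have "1 < p" using card_field_ge_2[where 'f='f] by (simp add: p_def)
  have "p powr (- real (k * d * CARD('r))) = inverse (p ^ (CARD('r) * k * d))"
    using \<open>1 < p\<close> by (subst powr_minus, subst powr_realpow) (auto simp: ac_simps)
  then have "\<delta> * p powr (- real (k * d * CARD('r))) * real (card V) ^ k
      = real (card Q) / p ^ (CARD('r) * k * d)"
    using assms(8) by (simp add: divide_inverse)
  moreover have "Q \<subseteq> tuples (coset b V) k" using assms(7) by (auto simp: tuples_def)
  ultimately have "real (card ?B) * \<eta> ^ 2 * p ^ s \<le> 3 * real (card V) ^ d"
    using card_deviating_tuples_le[OF assms(4,6) _ assms(9), where a=a]
    by (simp add: tuples_def p_def conj_ac)
  with card_V_pos \<open>1 < p\<close> assms(9)
  have "real (card ?B) / real (card V) ^ d \<le> 3 * \<eta> powr (-2) * p powr (- real s)"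
    by (simp add: divide_le_eq powr_minus powr_realpow field_simps)
  also have "\<dots> \<le> 3 * \<eta> powr (-2) * p powr (- real s / 4)"
    using \<open>1 < p\<close> by (intro mult_left_mono powr_mono) auto
  finally show ?thesis by (simp add: p_def)
qed

end
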